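(* Let $a\in(0,1)$ and let $\rho,\sigma_1,\sigma_2$ be states with $T(\sigma_1,\sigma_2)=t$. Then $$|S_a(\rho\|\sigma_1)-S_a(\rho\|\sigma_2)|\le 1-S_a(1\|t)=\frac{\log(a+(1-a)t)-\log a}{-\log a}\le \frac{1-a}{-a\log a}\,t.$$ Moreover, equality in the first inequality holds when $\rho\perp\sigma_1$ (i.e. $\mathrm{Tr}\,\rho\sigma_1=0$) and $\sigma_2=t\rho+(1-t)\sigma_1$.
   Context: All operators act on a finite-dimensional complex Hilbert space; a state is a positive semidefinite operator of trace one. $T(\rho,\sigma)=\frac12\|\rho-\sigma\|_1=\mathrm{Tr}(\rho-\sigma)_+$ is the trace distance, where $X_+=(X+|X|)/2$. For positive semidefinite $A,B$, the relative entropy is $S(A\|B)=\mathrm{Tr}\,A(\log A-\log B)$ (logarithms taken on supports, $0\log 0=0$, and $S(A\|B)=+\infty$ if the support of $A$ is not contained in that of $B$). For $a\in(0,1)$ the telescopic relative entropy is $S_a(A\|B)=\frac{1}{-\log a}S(A\|aA+(1-a)B)$. For nonnegative scalars $b,c$ this reads $S_a(b\|c)=\frac{b(\log b-\log(ab+(1-a)c))}{-\log a}$ (with $0\log 0=0$). *)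

theory Defs
  imports "HOL-Analysis.Analysis"
begin

type_synonym 'n cmat = "complex^'n^'n"

definition mtrace :: "'n::finite cmat \<Rightarrow> complex" where
  "mtrace A = (\<Sum>i\<in>UNIV. A $ i $ i)"

definition madj :: "'n::finite cmat \<Rightarrow> 'n cmat" where
  "madj A = (\<chi> i j. cnj (A $ j $ i))"

definition mdiag :: "('n::finite \<Rightarrow> complex) \<Rightarrow> 'n cmat" where
  "mdiag d = (\<chi> i j. if i = j then d i else 0)"

definition unitary_mat :: "'n::finite cmat \<Rightarrow> bool" where
  "unitary_mat U \<longleftrightarrow> madj U ** U = mat 1"

definition hermitian_mat :: "'n::finite cmat \<Rightarrow> bool" where
  "hermitian_mat A \<longleftrightarrow> madj A = A"

definition psd :: "'n::finite cmat \<Rightarrow> bool" where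
  "psd A \<longleftrightarrow> (\<forall>x::complex^'n.
     Im (\<Sum>i\<in>UNIV. cnj (x $ i) * (A *v x) $ i) = 0 \<and>
     Re (\<Sum>i\<in>UNIV. cnj (x $ i) * (A *v x) $ i) \<ge> 0)"

definition is_state :: "'n::finite cmat \<Rightarrow> bool" where
  "is_state \<rho> \<longleftrightarrow> psd \<rho> \<and> mtrace \<rho> = 1"

text \<open>Functional calculus for Hermitian matrices via spectral decomposition
  A = U diag(d) U*, f(A) = U diag(f o d) U* (independent of the decomposition).\<close>
definition mat_fun :: "(real \<Rightarrow> real) \<Rightarrow> 'n::finite cmat \<Rightarrow> 'n cmat" where
  "mat_fun f A = (SOME B. \<exists>U (d::'n \<Rightarrow> real). unitary_mat U \<and>
      A = U ** mdiag (\<lambda>i. complex_of_real (d i)) ** madj U \<and>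
      B = U ** mdiag (\<lambda>i. complex_of_real (f (d i))) ** madj U)"

definition pos_part :: "'n::finite cmat \<Rightarrow> 'n cmat" where
  "pos_part X = mat_fun (\<lambda>x. max x 0) X"

definition trace_dist :: "'n::finite cmat \<Rightarrow> 'n cmat \<Rightarrow> real" where
  "trace_dist \<rho> \<sigma> = Re (mtrace (pos_part (\<rho> - \<sigma>)))"

definition log_supp :: "'n::finite cmat \<Rightarrow> 'n cmat" where
  "log_supp A = mat_fun (\<lambda>x. if x > 0 then ln x else 0) A"

text \<open>supp A \<subseteq> supp B, equivalently ker B \<subseteq> ker A (for psd A, B).\<close>
definition supp_le :: "'n::finite cmat \<Rightarrow> 'n cmat \<Rightarrow> bool" where
  "supp_le A B \<longleftrightarrow> (\<forall>x. B *v x = 0 \<longrightarrow> A *v x = 0)"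

definition rel_ent :: "'n::finite cmat \<Rightarrow> 'n cmat \<Rightarrow> ereal" where
  "rel_ent A B = (if supp_le A B
      then ereal (Re (mtrace (A ** (log_supp A - log_supp B)))) else \<infinity>)"

definition tel_rel_ent :: "real \<Rightarrow> 'n::finite cmat \<Rightarrow> 'n cmat \<Rightarrow> ereal" where
  "tel_rel_ent a A B = rel_ent A (a *\<^sub>R A + (1 - a) *\<^sub>R B) / ereal (- ln a)"

definition tel_rel_ent_scalar :: "real \<Rightarrow> real \<Rightarrow> real \<Rightarrow> real" where
  "tel_rel_ent_scalar a b c =
     (if b = 0 then 0 else b * (ln b - ln (a * b + (1 - a) * c))) / (- ln a)"

end

theory Submission
  imports Defs "HOL-Real_Asymp.Real_Asymp"
begin

text \<open>
  With \<open>D\<^sub>i = a \<rho> + (1 - a) \<sigma>\<^sub>i\<close> the entropy difference is \<open>Tr \<rho> (log D\<^sub>2 - log D\<^sub>1)\<close> up to the factor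
  \<open>1 / (- log a)\<close>. Splitting \<open>\<sigma>\<^sub>2 - \<sigma>\<^sub>1\<close> into positive and negative part and using that \<open>log\<close> is operator
  monotone, it suffices to bound \<open>Tr \<rho> (log (D\<^sub>1 + X) - log D\<^sub>1)\<close> for positive semidefinite \<open>X\<close>
  with \<open>Tr X = s = (1 - a) t\<close>.

  Let \<open>\<langle>P, Q\<rangle> = Tr P T(Q)\<close>, where \<open>T\<close> is the derivative of \<open>log\<close> at \<open>D = D\<^sub>1 + \<theta> X\<close>. This form is
  positive semidefinite, nonnegative on pairs of positive semidefinite matrices, and
  \<open>\<langle>D, Q\<rangle> = Tr Q\<close>. As \<open>D \<ge> a \<rho> + \<theta> X\<close>, pairing with \<open>\<rho>\<close> and with \<open>X\<close> gives
  \<open>a \<langle>\<rho>, \<rho>\<rangle> + \<theta> u \<le> 1\<close> and \<open>a u + \<theta> \<langle>X, X\<rangle> \<le> s\<close> for \<open>u = \<langle>\<rho>, X\<rangle>\<close>. Together with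
  \<open>\<langle>X - s \<rho>, X - s \<rho>\<rangle> \<ge> 0\<close> this forces \<open>u \<le> s / (a + \<theta> s)\<close>, and integrating over
  \<open>\<theta> \<in> [0, 1]\<close> yields \<open>log (1 + s / a)\<close>. Singular \<open>D\<^sub>i\<close> are reached as limits of \<open>D\<^sub>i + \<epsilon>\<close>.
\<close>

subsection \<open>Matrix algebra\<close>

lemma matrix_mult_nth: "(A ** B) $ i $ j = (\<Sum>k\<in>UNIV. A $ i $ k * B $ k $ j)"
  by (simp add: matrix_matrix_mult_def)

lemma matrix_eqI: "(\<And>i j. A $ i $ j = B $ i $ j) \<Longrightarrow> A = B"
  by (simp add: vec_eq_iff)

lemma madj_nth [simp]: "madj A $ i $ j = cnj (A $ j $ i)"
  by (simp add: madj_def)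

lemma mdiag_nth: "mdiag d $ i $ j = (if i = j then d i else 0)"
  by (simp add: mdiag_def)

lemma matrix_diff_ldistrib: "A ** (B - C) = A ** B - A ** (C :: 'a::ring_1^'n^'n::finite)"
  by (intro matrix_eqI) (simp add: matrix_mult_nth algebra_simps sum_subtractf)

lemma matrix_diff_rdistrib: "(B - C) ** A = B ** A - (C :: 'a::ring_1^'n^'n::finite) ** A"
  by (intro matrix_eqI) (simp add: matrix_mult_nth algebra_simps sum_subtractf)

lemma matrix_add_rdistrib: "(B + C) ** A = B ** A + (C :: 'a::ring_1^'n^'n::finite) ** A"
  by (intro matrix_eqI) (simp add: matrix_mult_nth algebra_simps sum.distrib)

lemma matrix_scaleR_left: "(r *\<^sub>R A) ** B = r *\<^sub>R (A ** (B :: 'n::finite cmat))"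
  by (intro matrix_eqI) (simp add: matrix_mult_nth scaleR_sum_right)

lemma matrix_scaleR_right: "A ** (r *\<^sub>R B) = r *\<^sub>R (A ** (B :: 'n::finite cmat))"
  by (intro matrix_eqI) (simp add: matrix_mult_nth scaleR_sum_right)

lemma matrix_vector_scaleR:
  fixes A :: "'n::finite cmat"
  shows "A *v (r *\<^sub>R x) = r *\<^sub>R (A *v x)" "(r *\<^sub>R A) *v x = r *\<^sub>R (A *v x)"
  by (simp_all add: vec_eq_iff matrix_vector_mult_def scaleR_sum_right)

lemmas matrix_distribs = matrix_add_ldistrib matrix_add_rdistrib matrix_diff_ldistrib
  matrix_diff_rdistrib matrix_scaleR_left matrix_scaleR_right

lemma madj_madj [simp]: "madj (madj A) = A"
  by (intro matrix_eqI) simp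

lemma madj_mult: "madj (A ** B) = madj B ** madj A"
  by (intro matrix_eqI) (simp add: matrix_mult_nth mult.commute)

lemma madj_diff: "madj (A - B) = madj A - madj B"
  by (intro matrix_eqI) simp

lemma madj_mdiag: "madj (mdiag d) = mdiag (\<lambda>i. cnj (d i))"
  by (intro matrix_eqI) (auto simp: mdiag_nth)

lemma mdiag_mult_nth: "(mdiag d ** A) $ i $ j = d i * A $ i $ j"
proof -
  have "mdiag d $ i $ k * A $ k $ j = (if k = i then d i * A $ i $ j else 0)" for k
    by (auto simp: mdiag_nth)
  then show ?thesis by (simp add: matrix_mult_nth)
qed

lemma mult_mdiag_nth: "(A ** mdiag d) $ i $ j = A $ i $ j * d j"
proof -
  have "A $ i $ k * mdiag d $ k $ j = (if k = j then A $ i $ j * d j else 0)" for k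
    by (auto simp: mdiag_nth)
  then show ?thesis by (simp add: matrix_mult_nth)
qed

lemma mtrace_add: "mtrace (A + B) = mtrace A + mtrace B"
  by (simp add: mtrace_def sum.distrib)

lemma mtrace_diff: "mtrace (A - B) = mtrace A - mtrace B"
  by (simp add: mtrace_def sum_subtractf)

lemma mtrace_scaleR: "mtrace (r *\<^sub>R A) = r *\<^sub>R mtrace A"
  by (simp add: mtrace_def scaleR_sum_right)

lemma mtrace_mult_commute: "mtrace (A ** B) = mtrace (B ** A)"
  unfolding mtrace_def matrix_mult_nth
  by (subst sum.swap) (simp add: mult.commute)

lemma unitary_matD: "unitary_mat U \<Longrightarrow> madj U ** U = mat 1" "unitary_mat U \<Longrightarrow> U ** madj U = mat 1"
  by (simp_all add: unitary_mat_def matrix_left_right_inverse)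

subsection \<open>The sesquilinear form and positive semidefinite matrices\<close>

definition cdot :: "complex^'n::finite \<Rightarrow> complex^'n \<Rightarrow> complex" where
  "cdot x y = (\<Sum>i\<in>UNIV. cnj (x $ i) * y $ i)"

lemma cdot_add: "cdot (x + y) z = cdot x z + cdot y z" "cdot z (x + y) = cdot z x + cdot z y"
  by (simp_all add: cdot_def algebra_simps sum.distrib)

lemma cdot_diff: "cdot (x - y) z = cdot x z - cdot y z" "cdot z (x - y) = cdot z x - cdot z y"
  by (simp_all add: cdot_def algebra_simps sum_subtractf)

lemma cdot_smult: "cdot (c *s x) y = cnj c * cdot x y" "cdot x (c *s y) = c * cdot x y"
  by (simp_all add: cdot_def sum_distrib_left mult_ac)

lemma cdot_scaleR: "cdot (r *\<^sub>R x) y = r *\<^sub>R cdot x y" "cdot x (r *\<^sub>R y) = r *\<^sub>R cdot x y"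
  by (simp_all add: cdot_def scaleR_sum_right)

lemma cdot_sum_right: "cdot x (\<Sum>i\<in>I. f i) = (\<Sum>i\<in>I. cdot x (f i))"
  unfolding cdot_def by (subst sum.swap) (simp add: sum_distrib_left)

lemma cdot_zero [simp]: "cdot 0 x = 0" "cdot x 0 = 0"
  by (simp_all add: cdot_def)

lemma cnj_cdot: "cnj (cdot x y) = cdot y x"
  by (simp add: cdot_def mult.commute)

lemma cdot_self: "cdot x x = of_real ((norm x)\<^sup>2)"
proof -
  have "(norm x)\<^sup>2 = (\<Sum>i\<in>UNIV. (norm (x $ i))\<^sup>2)"
    by (simp add: norm_vec_def L2_set_def sum_nonneg)
  then show ?thesis
    by (simp add: cdot_def complex_norm_square mult.commute del: of_real_power)
qed

lemma cdot_matrix: "cdot x (A *v y) = cdot (madj A *v x) y"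
  unfolding cdot_def matrix_vector_mult_def
  by (simp add: sum_distrib_left sum_distrib_right mult_ac) (rule sum.swap)

lemma cdot_axis: "cdot (axis i 1) x = x $ i" "cdot x (axis i 1) = cnj (x $ i)"
proof -
  have *: "cnj (axis i 1 $ k) * y = (if k = i then y else 0)" "y * axis i 1 $ k = (if k = i then y else 0)" for k y
    by (auto simp: axis_def)
  show "cdot (axis i 1) x = x $ i" "cdot x (axis i 1) = cnj (x $ i)"
    by (simp_all add: cdot_def *)
qed

lemma matrix_axis_nth: "((A :: complex^'m::finite^'n::finite) *v axis j 1) $ i = A $ i $ j"
proof -
  have "A $ i $ k * axis j 1 $ k = (if k = j then A $ i $ k else 0)" for k
    by (auto simp: axis_def)
  then show ?thesis by (simp add: matrix_vector_mult_def)
qed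

lemma axis_matrix_nth: "cdot (axis i 1) (A *v axis j 1) = A $ i $ j"
  by (simp add: cdot_axis matrix_axis_nth)

lemma psd_cdot: "psd A \<longleftrightarrow> (\<forall>x. Im (cdot x (A *v x)) = 0 \<and> Re (cdot x (A *v x)) \<ge> 0)"
  by (simp add: psd_def cdot_def)

text \<open>Polarisation: the form is real at \<open>x + y\<close> and at
  \<open>x + \<i> *s y\<close>, which relates the imaginary and the real parts of the two mixed
  terms.\<close>

lemma psd_hermitian:
  assumes "psd A" shows "hermitian_mat A"
proof -
  have real: "Im (cdot x (A *v x)) = 0" for x
    using assms by (simp add: psd_cdot)
  have 1: "Im (cdot x (A *v y) + cdot y (A *v x)) = 0" for x y
    using real[of "x + y"] real[of x] real[of y]
    by (simp add: cdot_add matrix_vector_right_distrib)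
  have 2: "Re (cdot x (A *v y) - cdot y (A *v x)) = 0" for x y
    using 1[of x "\<i> *s y"] by (simp add: cdot_smult vec.scale)
  have "cdot y (A *v x) = cnj (cdot x (A *v y))" for x y
    using 1[of x y] 2[of x y] by (simp add: complex_eq_iff)
  then have "cnj (A $ j $ i) = A $ i $ j" for i j
    by (metis axis_matrix_nth)
  then show ?thesis
    unfolding hermitian_mat_def by (intro matrix_eqI) simp
qed

lemma psd_add: "psd A \<Longrightarrow> psd B \<Longrightarrow> psd (A + B)"
  by (simp add: psd_cdot matrix_vector_mult_add_rdistrib cdot_add)

lemma psd_scaleR: "psd A \<Longrightarrow> 0 \<le> r \<Longrightarrow> psd (r *\<^sub>R A)"
  by (simp add: psd_cdot cdot_scaleR matrix_vector_scaleR)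

lemma psd_congruence: "psd A \<Longrightarrow> psd (madj C ** A ** C)"
  by (simp add: psd_cdot cdot_matrix[of _ "madj C"] flip: matrix_vector_mul_assoc)

text \<open>First-order condition at a minimum: for small \<open>t\<close> of sign opposite to
  \<open>b\<close> the linear term would win, and \<open>t = - b / m\<close> with
  \<open>m > c\<close> is small enough.\<close>

lemma quadratic_nonneg_linear_coeff_zero:
  fixes b c :: real
  assumes nonneg: "\<And>t. 0 \<le> 2 * t * b + t\<^sup>2 * c"
  shows "b = 0"
proof (rule ccontr)
  assume "b \<noteq> 0"
  define m where "m = \<bar>c\<bar> + 1"
  have m: "m > 0" "c < m" by (auto simp: m_def)
  have "0 \<le> 2 * (- b / m) * b + (- b / m)\<^sup>2 * c" by (rule nonneg)
  also have "\<dots> = (b / m)\<^sup>2 * (c - 2 * m)"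
    using m by (simp add: field_simps power2_eq_square)
  also have "\<dots> < 0" using \<open>b \<noteq> 0\<close> m by (intro mult_pos_neg) auto
  finally show False by simp
qed

text \<open>The form attains its minimum 0 at \<open>x\<close>. Its derivative in the direction
  \<open>A *v x\<close> is twice the squared norm of \<open>A *v x\<close>, which must
  vanish.\<close>

lemma psd_ker:
  assumes "psd A" "cdot x (A *v x) = 0" shows "A *v x = 0"
proof -
  let ?y = "A *v x"
  have herm: "madj A = A" using psd_hermitian[OF assms(1)] by (simp add: hermitian_mat_def)
  have xy: "cdot x (A *v ?y) = cdot ?y ?y" using herm by (simp add: cdot_matrix)
  have "0 \<le> 2 * t * Re (cdot ?y ?y) + t\<^sup>2 * Re (cdot ?y (A *v ?y))" for t
  proof -
    have "0 \<le> Re (cdot (x + t *\<^sub>R ?y) (A *v (x + t *\<^sub>R ?y)))"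
      using assms(1) by (simp add: psd_cdot)
    also have "\<dots> = 2 * t * Re (cdot ?y ?y) + t\<^sup>2 * Re (cdot ?y (A *v ?y))"
      using assms(2) xy
      by (simp add: cdot_add cdot_scaleR matrix_vector_right_distrib matrix_vector_scaleR algebra_simps power2_eq_square)
    finally show ?thesis .
  qed
  from quadratic_nonneg_linear_coeff_zero[OF this] show ?thesis by (simp add: cdot_self)
qed

lemma psd_sum_ker:
  assumes "psd A" "psd B" "(A + B) *v x = 0" shows "A *v x = 0"
proof (rule psd_ker[OF assms(1)])
  have "cdot x (A *v x) + cdot x (B *v x) = 0"
    using assms(3) by (simp add: matrix_vector_mult_add_rdistrib flip: cdot_add)
  then show "cdot x (A *v x) = 0"
    using assms(1,2) by (auto simp: psd_cdot complex_eq_iff add_nonneg_eq_0_iff)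
qed

subsection \<open>The spectral theorem\<close>

definition spec :: "'n::finite cmat \<Rightarrow> ('n \<Rightarrow> real) \<Rightarrow> 'n cmat" where
  "spec U d = U ** mdiag (\<lambda>i. complex_of_real (d i)) ** madj U"

text \<open>Fewer than \<open>CARD('n)\<close> vectors span a proper subspace; a vector outside it
  minus its projection is nonzero and orthogonal to all of them.\<close>

lemma orthonormal_complement_nontrivial:
  fixes f :: "'n::finite \<Rightarrow> complex^'n"
  assumes "I \<noteq> UNIV" and on: "\<And>i j. i \<in> I \<Longrightarrow> j \<in> I \<Longrightarrow> cdot (f i) (f j) = (if i = j then 1 else 0)"
  obtains z where "z \<noteq> 0" "\<And>i. i \<in> I \<Longrightarrow> cdot (f i) z = 0"
proof -
  have "vec.dim (vec.span (f ` I)) \<le> card (f ` I)"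
    by (simp add: vec.dim_le_card')
  also have "\<dots> \<le> card I" by (simp add: card_image_le)
  also have "\<dots> < CARD('n)" using assms(1) by (auto intro: psubset_card_mono)
  finally have "vec.span (f ` I) \<noteq> UNIV" using vec_dim_card by (metis less_irrefl)
  then obtain y where y: "y \<notin> vec.span (f ` I)" by auto
  define z where "z = y - (\<Sum>i\<in>I. cdot (f i) y *s f i)"
  have "(\<Sum>i\<in>I. cdot (f i) y *s f i) \<in> vec.span (f ` I)"
    by (intro vec.span_sum vec.span_scale vec.span_base) auto
  with y have "z \<noteq> 0" by (auto simp: z_def)
  moreover have "cdot (f j) z = 0" if "j \<in> I" for j
  proof -
    have "cdot (f i) y * cdot (f j) (f i) = (if i = j then cdot (f j) y else 0)" if "i \<in> I" for i
      using that \<open>j \<in> I\<close> by (simp add: on)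
    then show ?thesis using that by (simp add: z_def cdot_diff cdot_sum_right cdot_smult)
  qed
  ultimately show ?thesis using that by blast
qed

text \<open>The complement of \<open>S\<close> is invariant under \<open>A\<close>, because
  \<open>S\<close> consists of eigenvectors, and a maximiser of the quadratic form on its unit
  sphere is an eigenvector.\<close>

lemma hermitian_eigenvector_in_complement:
  fixes A :: "'n::finite cmat" and S :: "(complex^'n) set"
  assumes "hermitian_mat A" and inv: "\<And>s. s \<in> S \<Longrightarrow> \<exists>l. A *v s = l *s s"
    and "z \<noteq> 0" "\<And>s. s \<in> S \<Longrightarrow> cdot s z = 0"
  obtains x and l :: real where "norm x = 1" "A *v x = complex_of_real l *s x" "\<And>s. s \<in> S \<Longrightarrow> cdot s x = 0"
proof -
  have herm: "madj A = A" using assms(1) by (simp add: hermitian_mat_def)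
  define V where "V = {x. \<forall>s\<in>S. cdot s x = 0}"
  let ?q = "\<lambda>x. Re (cdot x (A *v x))"
  have "V = (\<Inter>s\<in>S. {x. cdot s x = 0})" by (auto simp: V_def)
  then have closedV: "closed V"
    unfolding cdot_def by (auto intro!: closed_INT closed_Collect_eq continuous_intros)
  have "compact (sphere 0 1 \<inter> V)" using closedV by (simp add: compact_Int_closed)
  moreover have "(1 / norm z) *\<^sub>R z \<in> sphere 0 1 \<inter> V"
    using assms(3,4) by (auto simp: V_def cdot_scaleR)
  moreover have "continuous_on (sphere 0 1 \<inter> V) ?q"
    unfolding cdot_def matrix_vector_mult_def by (simp, intro continuous_intros)
  ultimately obtain x where x: "x \<in> sphere 0 1 \<inter> V" and max: "\<And>y. y \<in> sphere 0 1 \<inter> V \<Longrightarrow> ?q y \<le> ?q x"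
    using continuous_attains_sup[of "sphere 0 1 \<inter> V" ?q] by blast
  define l where "l = ?q x"
  have Vadd: "u + v \<in> V" and VscaleR: "r *\<^sub>R u \<in> V" if "u \<in> V" "v \<in> V" for u v r
    using that by (auto simp: V_def cdot_add cdot_scaleR)
  have VA: "A *v u \<in> V" if "u \<in> V" for u
  proof -
    have "cdot s (A *v u) = 0" if s: "s \<in> S" for s
    proof -
      obtain m where "A *v s = m *s s" using inv[OF s] by blast
      then show ?thesis using \<open>u \<in> V\<close> s by (simp add: cdot_matrix herm cdot_smult V_def)
    qed
    then show ?thesis by (simp add: V_def)
  qed
  have bound: "?q y \<le> l * (norm y)\<^sup>2" if "y \<in> V" for y
  proof (cases "y = 0")
    case False
    have "(1 / norm y) *\<^sub>R y \<in> sphere 0 1 \<inter> V" using False that VscaleR by auto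
    from max[OF this] False show ?thesis
      by (simp add: l_def cdot_scaleR matrix_vector_scaleR field_simps power2_eq_square)
  qed simp
  \<comment> \<open>The form of \<open>?M\<close> is nonnegative on \<open>V\<close> and 0 at
    \<open>x\<close>, so the argument of \<open>psd_ker\<close>, carried out inside
    \<open>V\<close>, shows that \<open>?M\<close> kills \<open>x\<close>.\<close>
  let ?M = "\<lambda>y. l *\<^sub>R y - A *v y"
  have pos: "0 \<le> Re (cdot y (?M y))" if "y \<in> V" for y
    using bound[OF that] by (simp add: cdot_diff cdot_scaleR cdot_self)
  have xV: "x \<in> V" and nx: "norm x = 1" using x by auto
  let ?w = "?M x"
  have wV: "?w \<in> V" using Vadd[OF VscaleR[OF xV xV, of l] VscaleR[OF VA VA, OF xV xV, of "-1"]] by simp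
  have xx: "cdot x x = 1" using nx by (simp add: cdot_self)
  have Axx: "Re (cdot x ?w) = 0" by (simp add: cdot_diff cdot_scaleR xx l_def)
  have xMw: "cdot x (?M ?w) = cdot ?w ?w"
    by (simp add: cdot_diff cdot_scaleR matrix_vector_mult_diff_distrib matrix_vector_scaleR cdot_matrix[of x] herm)
  have "0 \<le> 2 * t * Re (cdot ?w ?w) + t\<^sup>2 * Re (cdot ?w (?M ?w))" for t
  proof -
    let ?y = "x + t *\<^sub>R ?w"
    have "0 \<le> Re (cdot ?y (?M ?y))" by (intro pos Vadd VscaleR[OF wV wV] xV)
    also have "?M ?y = ?w + t *\<^sub>R ?M ?w"
      by (simp add: matrix_vector_right_distrib matrix_vector_scaleR matrix_vector_mult_diff_distrib algebra_simps)
    also have "Re (cdot ?y (?w + t *\<^sub>R ?M ?w)) = 2 * t * Re (cdot ?w ?w) + t\<^sup>2 * Re (cdot ?w (?M ?w))"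
      unfolding cdot_add cdot_scaleR xMw by (simp add: Axx power2_eq_square distrib_left)
    finally show ?thesis .
  qed
  then have "Re (cdot ?w ?w) = 0" by (rule quadratic_nonneg_linear_coeff_zero)
  then have "?w = 0" by (simp add: cdot_self)
  then have "A *v x = complex_of_real l *s x" by (simp add: vec_eq_iff scaleR_conv_of_real[where 'a = complex])
  then show ?thesis using that nx xV by (auto simp: V_def)
qed

theorem spectral_decomposition:
  fixes A :: "'n::finite cmat"
  assumes "hermitian_mat A"
  obtains U d where "unitary_mat U" "A = spec U d"
proof -
  \<comment> \<open>Induction over the index set: the eigenvectors indexed by \<open>I\<close> are
    kept, and one orthogonal to them is added for \<open>k\<close>.\<close>
  have "\<exists>f (d :: 'n \<Rightarrow> real). (\<forall>i\<in>I. \<forall>j\<in>I. cdot (f i) (f j) = (if i = j then 1 else 0)) \<and>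
          (\<forall>i\<in>I. A *v f i = complex_of_real (d i) *s f i)" for I :: "'n set"
  proof (induction I rule: finite_induct[OF finite])
    case 1
    show ?case by simp
  next
    case (2 k I)
    then obtain f d where on: "\<And>i j. i \<in> I \<Longrightarrow> j \<in> I \<Longrightarrow> cdot (f i) (f j) = (if i = j then 1 else 0)"
      and ev: "\<And>i. i \<in> I \<Longrightarrow> A *v f i = complex_of_real (d i) *s f i" by blast
    obtain z where z: "z \<noteq> 0" "\<And>i. i \<in> I \<Longrightarrow> cdot (f i) z = 0"
      using orthonormal_complement_nontrivial[of I f] on 2(2) by blast
    obtain x l where x: "norm x = 1" "A *v x = complex_of_real l *s x" "\<And>s. s \<in> f ` I \<Longrightarrow> cdot s x = 0"
      using hermitian_eigenvector_in_complement[OF assms, of "f ` I" z] z ev by blast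
    have x': "cdot (f i) x = 0" "cdot x (f i) = 0" if "i \<in> I" for i
      using x(3)[of "f i"] that cnj_cdot[of "f i" x] by auto
    have xx: "cdot x x = 1" using x(1) by (simp add: cdot_self)
    show ?case
      using 2(2) on ev x(2) xx x'
      by (intro exI[of _ "f(k := x)"] exI[of _ "d(k := l)"]) auto
  qed
  from this[of UNIV] obtain f and d :: "'n \<Rightarrow> real"
    where on: "\<And>i j. cdot (f i) (f j) = (if i = j then 1 else 0)"
      and ev: "\<And>i. A *v f i = complex_of_real (d i) *s f i" by auto
  define U where "U = (\<chi> i j. f j $ i)"
  have U: "unitary_mat U"
    unfolding unitary_mat_def
    using on by (intro matrix_eqI) (simp add: matrix_mult_nth U_def mat_def cdot_def)
  have "A ** U = U ** mdiag (\<lambda>i. complex_of_real (d i))"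
  proof (intro matrix_eqI)
    fix i j
    have "(A ** U) $ i $ j = (A *v f j) $ i"
      by (simp add: matrix_mult_nth U_def matrix_vector_mult_def)
    then show "(A ** U) $ i $ j = (U ** mdiag (\<lambda>i. complex_of_real (d i))) $ i $ j"
      by (simp add: ev mult_mdiag_nth U_def)
  qed
  then have "A ** (U ** madj U) = spec U d"
    by (simp add: spec_def matrix_mul_assoc)
  then show ?thesis using that U by (simp add: unitary_matD)
qed

section \<open>Functional calculus in a fixed eigenbasis\<close>

lemma madj_spec [simp]: "madj (spec U d) = spec U d"
  by (simp add: spec_def madj_mult madj_mdiag matrix_mul_assoc)

lemma spec_mult:
  assumes "unitary_mat U" shows "spec U d ** spec U e = spec U (\<lambda>i. d i * e i)"
proof -
  let ?D = "mdiag (\<lambda>i. complex_of_real (d i))" and ?E = "mdiag (\<lambda>i. complex_of_real (e i))"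
  have "spec U d ** spec U e = U ** ?D ** (madj U ** U) ** ?E ** madj U"
    by (simp add: spec_def matrix_mul_assoc)
  also have "\<dots> = U ** (?D ** ?E) ** madj U"
    by (simp add: unitary_matD[OF assms] matrix_mul_assoc)
  also have "?D ** ?E = mdiag (\<lambda>i. complex_of_real (d i * e i))"
    by (intro matrix_eqI) (simp add: mdiag_mult_nth mdiag_nth)
  finally show ?thesis by (simp add: spec_def)
qed

lemma spec_add: "spec U d + spec U e = spec U (\<lambda>i. d i + e i)"
proof -
  have *: "mdiag (\<lambda>i. complex_of_real (d i + e i)) =
      mdiag (\<lambda>i. complex_of_real (d i)) + mdiag (\<lambda>i. complex_of_real (e i))"
    by (intro matrix_eqI) (simp add: mdiag_nth)
  show ?thesis unfolding spec_def * by (simp add: matrix_distribs)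
qed

lemma spec_scaleR: "r *\<^sub>R spec U d = spec U (\<lambda>i. r * d i)"
proof -
  have *: "mdiag (\<lambda>i. complex_of_real (r * d i)) = r *\<^sub>R mdiag (\<lambda>i. complex_of_real (d i))"
    by (intro matrix_eqI) (simp add: mdiag_nth scaleR_conv_of_real[where 'a = complex])
  show ?thesis unfolding spec_def * by (simp add: matrix_distribs)
qed

lemma spec_const:
  fixes U :: "'n::finite cmat"
  assumes "unitary_mat U" shows "spec U (\<lambda>_. r) = r *\<^sub>R mat 1"
proof -
  have "mdiag (\<lambda>_. 1) = (mat 1 :: 'n cmat)" by (intro matrix_eqI) (simp add: mdiag_nth mat_def)
  then have "spec U (\<lambda>_. 1) = mat 1"
    by (simp add: spec_def unitary_matD[OF assms])
  then show ?thesis using spec_scaleR[of r U "\<lambda>_. 1"] by simp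
qed

lemma spec_conjugate:
  assumes "unitary_mat U"
  shows "madj U ** spec U d ** U = mdiag (\<lambda>i. complex_of_real (d i))"
proof -
  have "madj U ** spec U d ** U = (madj U ** U) ** mdiag (\<lambda>i. complex_of_real (d i)) ** (madj U ** U)"
    by (simp add: spec_def matrix_mul_assoc)
  then show ?thesis by (simp add: unitary_matD[OF assms])
qed

lemma mtrace_mult_spec:
  "mtrace (P ** spec U g) = (\<Sum>j\<in>UNIV. (madj U ** P ** U) $ j $ j * complex_of_real (g j))"
proof -
  have "mtrace (P ** spec U g) = mtrace ((P ** U ** mdiag (\<lambda>i. complex_of_real (g i))) ** madj U)"
    by (simp add: spec_def matrix_mul_assoc)
  also have "\<dots> = mtrace (madj U ** P ** U ** mdiag (\<lambda>i. complex_of_real (g i)))"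
    by (subst mtrace_mult_commute) (simp add: matrix_mul_assoc)
  finally show ?thesis by (simp add: mtrace_def mult_mdiag_nth)
qed

lemma Re_mtrace_mult_spec:
  "Re (mtrace (P ** spec U g)) = (\<Sum>j\<in>UNIV. Re ((madj U ** P ** U) $ j $ j) * g j)"
  by (simp add: mtrace_mult_spec)

lemma mtrace_conjugate:
  assumes "unitary_mat U" shows "mtrace (madj U ** P ** U) = mtrace P"
proof -
  have "mtrace (madj U ** P ** U) = mtrace (U ** madj U ** P)"
    by (subst mtrace_mult_commute) (simp add: matrix_mul_assoc)
  then show ?thesis by (simp add: unitary_matD[OF assms])
qed

lemma psd_diag_nonneg: "psd P \<Longrightarrow> 0 \<le> Re (P $ i $ i)"
  by (metis axis_matrix_nth psd_cdot)

lemma psd_spec_iff: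
  assumes "unitary_mat U" shows "psd (spec U d) \<longleftrightarrow> (\<forall>i. 0 \<le> d i)"
proof
  assume "psd (spec U d)"
  from psd_diag_nonneg[OF psd_congruence[OF this, of U]] show "\<forall>i. 0 \<le> d i"
    by (simp add: spec_conjugate[OF assms] mdiag_nth)
next
  assume d: "\<forall>i. 0 \<le> d i"
  \<comment> \<open>Taking square roots of the eigenvalues exhibits the matrix as a congruence of
    the identity.\<close>
  have "spec U d = madj (spec U (\<lambda>i. sqrt (d i))) ** mat 1 ** spec U (\<lambda>i. sqrt (d i))"
    using d by (simp add: spec_mult[OF assms])
  moreover have "psd (mat 1)" by (simp add: psd_cdot cdot_self)
  ultimately show "psd (spec U d)" by (metis psd_congruence)
qed

text \<open>In an eigenbasis of \<open>Q\<close> the trace is the sum of the nonnegative diagonal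
  entries of \<open>P\<close>, weighted by the eigenvalues of \<open>Q\<close>.\<close>

lemma psd_mtrace_mult_nonneg:
  assumes "psd P" "psd Q" shows "0 \<le> Re (mtrace (P ** Q))"
proof -
  obtain V q where V: "unitary_mat V" "Q = spec V q"
    using spectral_decomposition psd_hermitian[OF assms(2)] by blast
  then have "\<forall>i. 0 \<le> q i" using assms(2) psd_spec_iff by blast
  then show ?thesis
    unfolding V(2) Re_mtrace_mult_spec
    by (intro sum_nonneg mult_nonneg_nonneg psd_diag_nonneg psd_congruence assms(1)) auto
qed

lemma psd_mtrace_nonneg: "psd P \<Longrightarrow> 0 \<le> Re (mtrace P)"
  unfolding mtrace_def by (auto intro!: sum_nonneg psd_diag_nonneg)

text \<open>Independence of \<open>mat_fun\<close> from the decomposition is the case \<open>C = mat 1\<close>.\<close>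

lemma spec_intertwine:
  fixes U V C :: "'n::finite cmat"
  assumes U: "unitary_mat U" and V: "unitary_mat V"
    and eq: "spec U d ** C = C ** spec V b"
  shows "spec U (\<lambda>i. f (d i)) ** C = C ** spec V (\<lambda>i. f (b i))"
proof -
  define M where "M = madj U ** C ** V"
  let ?D = "\<lambda>d. mdiag (\<lambda>i. complex_of_real (d i))"
  have left: "madj U ** (spec U d ** C) ** V = ?D d ** M" for d
  proof -
    have "madj U ** (spec U d ** C) ** V = (madj U ** U) ** ?D d ** madj U ** C ** V"
      by (simp add: spec_def matrix_mul_assoc)
    then show ?thesis by (simp add: unitary_matD[OF U] M_def matrix_mul_assoc)
  qed
  have right: "madj U ** (C ** spec V b) ** V = M ** ?D b" for b
  proof -
    have "madj U ** (C ** spec V b) ** V = madj U ** C ** V ** ?D b ** (madj V ** V)"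
      by (simp add: spec_def matrix_mul_assoc)
    then show ?thesis by (simp add: unitary_matD[OF V] M_def)
  qed
  have cancel: "P = Q" if "madj U ** P ** V = madj U ** Q ** V" for P Q :: "'n cmat"
  proof -
    have "U ** (madj U ** P ** V) ** madj V = U ** (madj U ** Q ** V) ** madj V"
      using that by simp
    then have "(U ** madj U) ** P ** (V ** madj V) = (U ** madj U) ** Q ** (V ** madj V)"
      by (simp add: matrix_mul_assoc)
    then show ?thesis by (simp add: unitary_matD[OF U] unitary_matD[OF V])
  qed
  have "(?D d ** M) $ i $ j = (M ** ?D b) $ i $ j" for i j
    using arg_cong[OF eq, of "\<lambda>A. madj U ** A ** V"] by (simp only: left right)
  then have "complex_of_real (d i) * M $ i $ j = M $ i $ j * complex_of_real (b j)" for i j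
    by (simp only: mdiag_mult_nth mult_mdiag_nth)
  \<comment> \<open>Nonzero entries of \<open>M\<close> occur only where the eigenvalues agree, and
    there \<open>f (d i) = f (b j)\<close> as well.\<close>
  then have "M $ i $ j = 0 \<or> d i = b j" for i j by auto
  then have "?D (\<lambda>i. f (d i)) ** M = M ** ?D (\<lambda>i. f (b i))"
    by (intro matrix_eqI) (metis mdiag_mult_nth mult_mdiag_nth mult_zero_left mult_zero_right mult.commute)
  then have "madj U ** (spec U (\<lambda>i. f (d i)) ** C) ** V = madj U ** (C ** spec V (\<lambda>i. f (b i))) ** V"
    by (simp only: left right)
  then show ?thesis by (rule cancel)
qed

lemma mat_fun_spec:
  assumes U: "unitary_mat U"
  shows "mat_fun f (spec U d) = spec U (\<lambda>i. f (d i))"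
  unfolding mat_fun_def spec_def[symmetric]
proof (rule some_equality)
  show "\<exists>V b. unitary_mat V \<and> spec U d = spec V b \<and> spec U (\<lambda>i. f (d i)) = spec V (\<lambda>i. f (b i))"
    using U by blast
next
  fix B assume "\<exists>V b. unitary_mat V \<and> spec U d = spec V b \<and> B = spec V (\<lambda>i. f (b i))"
  then obtain V b where V: "unitary_mat V" "spec U d = spec V b" "B = spec V (\<lambda>i. f (b i))" by blast
  then show "B = spec U (\<lambda>i. f (d i))"
    using spec_intertwine[OF U V(1), of d "mat 1" b f] by simp
qed

subsection \<open>The quadratic form of the derivative of the logarithm\<close>

text \<open>The first divided difference of \<open>ln\<close>, completed by the derivative on the
  diagonal. In the eigenbasis of a matrix, the derivative of log multiplies entry
  \<open>(i, j)\<close> by this factor.\<close>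

definition log_dd :: "real \<Rightarrow> real \<Rightarrow> real" where
  "log_dd x y = (if x = y then 1 / x else (ln y - ln x) / (y - x))"

text \<open>The integral of \<open>1 / ((x + s) * (y + s))\<close> over \<open>s \<in> {0..r}\<close>; it tends to \<open>log_dd x y\<close>.\<close>

definition log_dd_upto :: "real \<Rightarrow> real \<Rightarrow> real \<Rightarrow> real" where
  "log_dd_upto r x y = (if x = y then 1 / x - 1 / (x + r)
     else (ln y - ln x - (ln (y + r) - ln (x + r))) / (y - x))"

lemma log_dd_upto_0 [simp]: "log_dd_upto 0 x y = 0"
  by (simp add: log_dd_upto_def)

lemma log_dd_pos: "0 < x \<Longrightarrow> 0 < y \<Longrightarrow> 0 < log_dd x y"
  by (cases x y rule: linorder_cases)
     (auto simp: log_dd_def divide_neg_neg)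

text \<open>Partial fractions. Together with the limit at infinity this replaces the integral
  representation of \<open>log_dd\<close>.\<close>

lemma log_dd_upto_deriv:
  assumes "0 < x" "0 < y" "0 \<le> r"
  shows "((\<lambda>r. log_dd_upto r x y) has_real_derivative 1 / ((x + r) * (y + r))) (at r)"
proof (cases "x = y")
  case True
  have "((\<lambda>r. c - 1 / (x + r)) has_real_derivative 1 / ((x + r) * (x + r))) (at r)" for c
    using assms by (auto intro!: derivative_eq_intros simp: field_simps)
  with True show ?thesis by (simp add: log_dd_upto_def)
next
  case False
  have "((\<lambda>r. (ln y - ln x - (ln (y + r) - ln (x + r))) / (y - x)) has_real_derivative
      (1 / (x + r) - 1 / (y + r)) / (y - x)) (at r)"
    using assms False by (auto intro!: derivative_eq_intros)
  also have "(1 / (x + r) - 1 / (y + r)) / (y - x) = 1 / ((x + r) * (y + r))"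
    using assms False by (simp add: divide_simps)
  finally show ?thesis using False by (simp add: log_dd_upto_def)
qed

lemma log_dd_upto_tendsto: "((\<lambda>r. log_dd_upto r x y) \<longlongrightarrow> log_dd x y) at_top"
proof (cases "x = y")
  case True
  have "((\<lambda>r. 1 / x - 1 / (x + r)) \<longlongrightarrow> 1 / x) at_top" by real_asymp
  with True show ?thesis by (simp add: log_dd_upto_def log_dd_def)
next
  case False
  have "((\<lambda>r. ln (y + r) - ln (x + r)) \<longlongrightarrow> 0) at_top" by real_asymp
  from tendsto_divide[OF tendsto_diff[OF tendsto_const[of "ln y - ln x"] this] tendsto_const[of "y - x"]]
  show ?thesis using False by (simp add: log_dd_upto_def log_dd_def)
qed

text \<open>Nonnegativity of an improper integral over \<open>r \<ge> 0\<close>, phrased through an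
  antiderivative.\<close>

lemma le_limit_of_nonneg_deriv:
  fixes f :: "real \<Rightarrow> real"
  assumes "\<And>r. 0 \<le> r \<Longrightarrow> (f has_real_derivative f' r) (at r)" "\<And>r. 0 \<le> r \<Longrightarrow> 0 \<le> f' r"
    and "(f \<longlongrightarrow> l) at_top"
  shows "f 0 \<le> l"
proof (rule tendsto_lowerbound[OF assms(3)])
  show "\<forall>\<^sub>F r in at_top. f 0 \<le> f r"
    using eventually_ge_at_top[of 0]
  proof eventually_elim
    case (elim r)
    then show ?case
    proof (rule DERIV_nonneg_imp_nondecreasing)
      fix x :: real assume "0 \<le> x"
      then show "\<exists>y. (f has_real_derivative y) (at x) \<and> 0 \<le> y"
        using assms(1,2) by blast
    qed
  qed
qed simp

text \<open>The form \<open>\<langle>P, Q\<rangle>\<close> at \<open>D = spec U d\<close>, where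
  \<open>T\<close> is entrywise multiplication by \<open>log_dd\<close> in the eigenbasis. For
  Hermitian \<open>Q\<close> the conjugate entry is the transposed one, as in a trace.\<close>

definition log_form :: "'n::finite cmat \<Rightarrow> ('n \<Rightarrow> real) \<Rightarrow> 'n cmat \<Rightarrow> 'n cmat \<Rightarrow> real" where
  "log_form U d P Q = (\<Sum>i\<in>UNIV. \<Sum>j\<in>UNIV. log_dd (d i) (d j) *
     Re ((madj U ** P ** U) $ i $ j * cnj ((madj U ** Q ** U) $ i $ j)))"

lemma log_form_commute: "log_form U d P Q = log_form U d Q P"
proof -
  have *: "r * Re (x * cnj y) = r * Re (y * cnj x)" for r x y by simp
  show ?thesis unfolding log_form_def by (intro sum.cong refl *)
qed

lemma log_form_diff_left: "log_form U d (P - Q) R = log_form U d P R - log_form U d Q R"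
  unfolding log_form_def matrix_distribs sum_subtractf[symmetric]
  by (intro sum.cong refl) (simp add: right_diff_distrib left_diff_distrib)

lemma log_form_scaleR_left: "log_form U d (r *\<^sub>R P) R = r * log_form U d P R"
  unfolding log_form_def matrix_distribs sum_distrib_left
  by (intro sum.cong refl) (simp add: right_diff_distrib distrib_left)

lemma log_form_diff_right: "log_form U d R (P - Q) = log_form U d R P - log_form U d R Q"
  by (metis log_form_commute log_form_diff_left)

lemma log_form_scaleR_right: "log_form U d R (r *\<^sub>R P) = r * log_form U d R P"
  by (metis log_form_commute log_form_scaleR_left)

lemma log_form_self_nonneg:
  assumes "\<And>i. 0 < d i" shows "0 \<le> log_form U d P P"
  unfolding log_form_def
  by (intro sum_nonneg mult_nonneg_nonneg less_imp_le[OF log_dd_pos] assms) (simp add: complex_mult_cnj)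

text \<open>\<open>D\<close> is diagonal in its own eigenbasis, where \<open>log_dd\<close> is
  \<open>1 / d i\<close>, so the eigenvalues cancel.\<close>

lemma log_form_spec_left:
  assumes "unitary_mat U" "\<And>i. 0 < d i"
  shows "log_form U d (spec U d) P = Re (mtrace P)"
proof -
  have "log_form U d (spec U d) P =
      (\<Sum>i\<in>UNIV. \<Sum>j\<in>UNIV. if i = j then Re ((madj U ** P ** U) $ i $ i) else 0)"
    unfolding log_form_def spec_conjugate[OF assms(1)]
    using assms(2)[THEN less_imp_neq, symmetric] by (intro sum.cong refl) (auto simp: mdiag_nth log_dd_def)
  also have "\<dots> = Re (mtrace (madj U ** P ** U))" by (simp add: mtrace_def)
  finally show ?thesis by (simp add: mtrace_conjugate[OF assms(1)])
qed

text \<open>Multiplying by a diagonal matrix on both sides scales entry \<open>(i, j)\<close> by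
  \<open>e i * e j\<close>. For \<open>e i = 1 / (d i + r)\<close> this factor is the integrand of
  \<open>log_dd\<close>.\<close>

lemma mtrace_sandwich:
  assumes "hermitian_mat Q"
  shows "Re (mtrace (P ** (spec U e ** Q ** spec U e))) =
    (\<Sum>i\<in>UNIV. \<Sum>j\<in>UNIV. e i * e j * Re ((madj U ** P ** U) $ i $ j * cnj ((madj U ** Q ** U) $ i $ j)))"
proof -
  let ?E = "mdiag (\<lambda>i. complex_of_real (e i))"
  define P' Q' where "P' = madj U ** P ** U" and "Q' = madj U ** Q ** U"
  have Q': "cnj (Q' $ i $ j) = Q' $ j $ i" for i j
  proof -
    have "madj Q' = Q'"
      using assms by (simp add: Q'_def madj_mult matrix_mul_assoc hermitian_mat_def)
    then show ?thesis by (metis madj_nth)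
  qed
  have "mtrace (P ** (spec U e ** Q ** spec U e)) = mtrace ((P ** U ** ?E ** Q' ** ?E) ** madj U)"
    by (simp add: spec_def Q'_def matrix_mul_assoc)
  also have "\<dots> = mtrace ((P' ** ?E) ** (Q' ** ?E))"
    by (subst mtrace_mult_commute) (simp add: P'_def matrix_mul_assoc)
  also have "\<dots> = (\<Sum>i\<in>UNIV. \<Sum>j\<in>UNIV. (P' $ i $ j * complex_of_real (e j)) * (Q' $ j $ i * complex_of_real (e i)))"
    unfolding mtrace_def matrix_mult_nth[of "P' ** ?E"] by (simp add: mult_mdiag_nth)
  also have "Re \<dots> = (\<Sum>i\<in>UNIV. \<Sum>j\<in>UNIV. e i * e j * Re (P' $ i $ j * cnj (Q' $ i $ j)))"
  proof -
    have "Re ((x * complex_of_real (e j)) * (y * complex_of_real (e i))) = e i * e j * Re (x * y)" for x y i j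
      by (simp add: right_diff_distrib mult_ac)
    then show ?thesis unfolding Re_sum Q' by (simp only:)
  qed
  finally show ?thesis unfolding P'_def Q'_def .
qed

text \<open>The form is the integral over \<open>r\<close> of \<open>Tr P R Q R\<close> with the
  resolvent \<open>R = (D + r)^(-1)\<close>, and \<open>R Q R\<close> is positive
  semidefinite.\<close>

lemma log_form_nonneg:
  assumes d: "\<And>i. 0 < d i" and P: "psd P" and Q: "psd Q"
  shows "0 \<le> log_form U d P Q"
proof -
  define c where "c i j = Re ((madj U ** P ** U) $ i $ j * cnj ((madj U ** Q ** U) $ i $ j))" for i j
  define F where "F r = (\<Sum>i\<in>UNIV. \<Sum>j\<in>UNIV. log_dd_upto r (d i) (d j) * c i j)" for r
  define F' where "F' r = (\<Sum>i\<in>UNIV. \<Sum>j\<in>UNIV. 1 / ((d i + r) * (d j + r)) * c i j)" for r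
  have "F 0 \<le> log_form U d P Q"
  proof (rule le_limit_of_nonneg_deriv)
    show "(F has_real_derivative F' r) (at r)" if "0 \<le> r" for r
      unfolding F_def F'_def
      using that d by (intro DERIV_sum DERIV_cmult_right log_dd_upto_deriv) auto
    show "0 \<le> F' r" for r
    proof -
      let ?S = "spec U (\<lambda>i. 1 / (d i + r))"
      have "F' r = Re (mtrace (P ** (?S ** Q ** ?S)))"
        unfolding mtrace_sandwich[OF psd_hermitian[OF Q]] F'_def c_def[symmetric] by simp
      also have "0 \<le> \<dots>"
        using psd_mtrace_mult_nonneg[OF P] psd_congruence[OF Q, of ?S] by simp
      finally show ?thesis .
    qed
    show "(F \<longlongrightarrow> log_form U d P Q) at_top"
      unfolding F_def log_form_def c_def[symmetric]
      by (intro tendsto_sum tendsto_mult_right log_dd_upto_tendsto)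
  qed
  then show ?thesis by (simp add: F_def)
qed

text \<open>Operator concavity of the logarithm. Both sides are integrals over \<open>r \<ge> 0\<close> of resolvent expressions
  at \<open>r\<close>, so the inequality is checked on the integrands: their difference is \<open>Tr P (C B C)\<close> with
  \<open>B = spec V b + r\<close> and \<open>C\<close> the difference of the two resolvents.\<close>

lemma log_tangent:
  fixes U V P :: "'n::finite cmat"
  assumes U: "unitary_mat U" and V: "unitary_mat V"
    and d: "\<And>i. 0 < d i" and b: "\<And>i. 0 < b i" and P: "psd P"
  shows "Re (mtrace (P ** spec V (\<lambda>i. ln (b i)))) - Re (mtrace (P ** spec U (\<lambda>i. ln (d i))))
     \<le> log_form U d P (spec V b - spec U d)"
proof -
  define X where "X = spec V b - spec U d"
  have hX: "hermitian_mat X"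
    by (simp add: X_def hermitian_mat_def madj_diff)
  define c where "c i j = Re ((madj U ** P ** U) $ i $ j * cnj ((madj U ** X ** U) $ i $ j))" for i j
  define p where "p i = Re ((madj U ** P ** U) $ i $ i)" for i
  define q where "q i = Re ((madj V ** P ** V) $ i $ i)" for i
  have sum_p: "sum p UNIV = Re (mtrace P)"
    using mtrace_conjugate[OF U, of P] by (simp add: p_def mtrace_def flip: Re_sum)
  have sum_q: "sum q UNIV = Re (mtrace P)"
    using mtrace_conjugate[OF V, of P] by (simp add: q_def mtrace_def flip: Re_sum)
  \<comment> \<open>\<open>F\<close> runs from the left-hand side of the claim at
    \<open>r = 0\<close> to its right-hand side as \<open>r\<close> tends to infinity.\<close>
  define F where "F r = (\<Sum>i\<in>UNIV. \<Sum>j\<in>UNIV. log_dd_upto r (d i) (d j) * c i j)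
    - ((\<Sum>i\<in>UNIV. p i * ln (d i + r)) - (\<Sum>i\<in>UNIV. q i * ln (b i + r)))" for r
  define F' where "F' r = (\<Sum>i\<in>UNIV. \<Sum>j\<in>UNIV. 1 / ((d i + r) * (d j + r)) * c i j)
    - ((\<Sum>i\<in>UNIV. p i * (1 / (d i + r))) - (\<Sum>i\<in>UNIV. q i * (1 / (b i + r))))" for r
  have "F 0 \<le> log_form U d P X"
  proof (rule le_limit_of_nonneg_deriv)
    show "(F has_real_derivative F' r) (at r)" if "0 \<le> r" for r
    proof -
      have ln: "((\<lambda>r. ln (x + r)) has_real_derivative 1 / (x + r)) (at r)" if "0 < x" for x
        using that \<open>0 \<le> r\<close> by (auto intro!: derivative_eq_intros)
      show ?thesis
        unfolding F_def F'_def
        using that d b by (intro DERIV_diff DERIV_sum DERIV_cmult_right DERIV_cmult log_dd_upto_deriv ln) auto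
    qed
    show "0 \<le> F' r" if "0 \<le> r" for r
    proof -
      let ?A = "spec U (\<lambda>i. 1 / (d i + r))" and ?B = "spec V (\<lambda>i. 1 / (b i + r))"
      let ?A' = "spec U (\<lambda>i. d i + r)" and ?B' = "spec V (\<lambda>i. b i + r)"
      have nz: "d i + r \<noteq> 0" "b i + r \<noteq> 0" for i
        using d[of i] b[of i] that by auto
      have inv: "?A ** ?A' = mat 1" "?A' ** ?A = mat 1" "?B ** ?B' = mat 1" "?B' ** ?B = mat 1"
        by (simp_all add: spec_mult U V nz spec_const)
      have shift: "spec W (\<lambda>i. e i + r) = spec W e + r *\<^sub>R mat 1" if "unitary_mat W" for W and e :: "'n \<Rightarrow> real"
        using spec_add[of W e "\<lambda>_. r"] by (simp add: spec_const[OF that])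
      have B': "?B' = ?A' + X"
        by (simp add: shift U V X_def)
      let ?C = "?B - ?A"
      have hC: "madj ?C = ?C"
        by (simp add: madj_diff)
      \<comment> \<open>\<open>?A\<close> and \<open>?B\<close> invert \<open>?A'\<close> and
        \<open>?B' = ?A' + X\<close>, so the resolvent identity gives
        \<open>?C ** ?B' = - (?A ** X)\<close>; expanding the right factor \<open>?C\<close> yields
        the integrand.\<close>
      have "?C ** ?B' ** ?C = ?A ** X ** ?A - (?A - ?B)"
      proof -
        have "?C ** ?B' = mat 1 - ?A ** ?B'" by (simp add: matrix_distribs inv)
        also have "?A ** ?B' = mat 1 + ?A ** X" by (simp add: B' matrix_distribs inv)
        finally have CB: "?C ** ?B' = - (?A ** X)" by simp
        have "?C ** ?B' ** ?B = ?C" by (simp add: inv flip: matrix_mul_assoc)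
        then have "?C ** ?B' ** ?C = ?C - ?C ** ?B' ** ?A" by (simp add: matrix_diff_ldistrib)
        also have "?C ** ?B' ** ?A = - (?A ** X ** ?A)"
          unfolding CB using matrix_diff_rdistrib[of 0 "?A ** X" ?A] by simp
        finally show ?thesis by simp
      qed
      moreover have "psd (?C ** ?B' ** ?C)"
      proof -
        have "psd ?B'" using b that by (simp add: psd_spec_iff[OF V] add_nonneg_nonneg less_imp_le)
        from psd_congruence[OF this, of ?C] show ?thesis by (simp add: hC)
      qed
      ultimately have "0 \<le> Re (mtrace (P ** (?A ** X ** ?A - (?A - ?B))))"
        using psd_mtrace_mult_nonneg[OF P] by metis
      also have "\<dots> = Re (mtrace (P ** (?A ** X ** ?A))) - (Re (mtrace (P ** ?A)) - Re (mtrace (P ** ?B)))"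
        by (simp add: matrix_diff_ldistrib mtrace_diff)
      also have "\<dots> = F' r"
        unfolding F'_def p_def q_def c_def[symmetric] mtrace_sandwich[OF hX] Re_mtrace_mult_spec by simp
      finally show ?thesis .
    qed
    show "(F \<longlongrightarrow> log_form U d P X) at_top"
    proof -
      \<comment> \<open>Each logarithmic sum alone behaves like \<open>ln r\<close> times the trace
        of \<open>P\<close>. As \<open>p\<close> and \<open>q\<close> have the same sum, subtracting
        \<open>ln r\<close> in both leaves the difference unchanged.\<close>
      have ln: "((\<lambda>r. ln (x + r) - ln r) \<longlongrightarrow> 0) at_top" for x :: real
        by real_asymp
      have "((\<lambda>r. (\<Sum>i\<in>UNIV. p i * (ln (d i + r) - ln r)) - (\<Sum>i\<in>UNIV. q i * (ln (b i + r) - ln r)))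
          \<longlongrightarrow> (\<Sum>i\<in>UNIV. p i * 0) - (\<Sum>i\<in>UNIV. q i * 0)) at_top"
        by (intro tendsto_diff tendsto_sum tendsto_mult_left ln)
      moreover have "(\<Sum>i\<in>UNIV. p i * (ln (d i + r) - ln r)) - (\<Sum>i\<in>UNIV. q i * (ln (b i + r) - ln r))
          = (\<Sum>i\<in>UNIV. p i * ln (d i + r)) - (\<Sum>i\<in>UNIV. q i * ln (b i + r))" for r
        by (simp add: right_diff_distrib sum_subtractf sum_p sum_q flip: sum_distrib_right)
      ultimately have "((\<lambda>r. (\<Sum>i\<in>UNIV. p i * ln (d i + r)) - (\<Sum>i\<in>UNIV. q i * ln (b i + r))) \<longlongrightarrow> 0) at_top"
        by simp
      moreover have "((\<lambda>r. \<Sum>i\<in>UNIV. \<Sum>j\<in>UNIV. log_dd_upto r (d i) (d j) * c i j) \<longlongrightarrow> log_form U d P X) at_top"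
        unfolding log_form_def c_def[symmetric]
        by (intro tendsto_sum tendsto_mult_right log_dd_upto_tendsto)
      ultimately show ?thesis
        unfolding F_def using tendsto_diff by fastforce
    qed
  qed
  then show ?thesis
    by (simp add: F_def Re_mtrace_mult_spec p_def q_def X_def)
qed

lemma log_form_le:
  assumes U: "unitary_mat U" and d: "\<And>i. 0 < d i" and "0 < a" "0 \<le> \<theta>"
    and P: "psd P" "mtrace P = 1" and X: "psd X" and dom: "psd (spec U d - a *\<^sub>R P - \<theta> *\<^sub>R X)"
  shows "log_form U d P X \<le> Re (mtrace X) / (a + \<theta> * Re (mtrace X))"
proof -
  define s where "s = Re (mtrace X)"
  define u p q where "u = log_form U d P X" and "p = log_form U d P P" and "q = log_form U d X X"
  have s: "0 \<le> s" unfolding s_def by (rule psd_mtrace_nonneg[OF X])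
  have "0 \<le> log_form U d (spec U d - a *\<^sub>R P - \<theta> *\<^sub>R X) P"
    by (intro log_form_nonneg d dom P)
  then have 1: "a * p + \<theta> * u \<le> 1"
    by (simp add: log_form_diff_left log_form_scaleR_left log_form_spec_left[OF U d] P(2)
        log_form_commute[of U d X P] u_def p_def)
  have "0 \<le> log_form U d (spec U d - a *\<^sub>R P - \<theta> *\<^sub>R X) X"
    by (intro log_form_nonneg d dom X)
  then have 2: "a * u + \<theta> * q \<le> s"
    by (simp add: log_form_diff_left log_form_scaleR_left log_form_spec_left[OF U d] u_def q_def s_def)
  have "0 \<le> log_form U d (X - s *\<^sub>R P) (X - s *\<^sub>R P)"
    by (intro log_form_self_nonneg d)
  then have 3: "0 \<le> q - 2 * s * u + s\<^sup>2 * p"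
    by (simp add: log_form_diff_left log_form_diff_right log_form_scaleR_left log_form_scaleR_right
        log_form_commute[of U d X P] u_def p_def q_def power2_eq_square algebra_simps)
  \<comment> \<open>The weights \<open>a\<close>, \<open>s\<^sup>2 * \<theta>\<close> and
    \<open>a * \<theta>\<close> are chosen so that \<open>p\<close> and \<open>q\<close> cancel once
    the three inequalities are inserted.\<close>
  have "u * (a + \<theta> * s)\<^sup>2 = a * (a * u) + s\<^sup>2 * \<theta> * (\<theta> * u) + a * \<theta> * (2 * s * u)"
    by (simp add: power2_eq_square algebra_simps)
  also have "\<dots> \<le> a * (s - \<theta> * q) + s\<^sup>2 * \<theta> * (1 - a * p) + a * \<theta> * (q + s\<^sup>2 * p)"
    using 1 2 3 s assms(3,4) by (intro add_mono mult_left_mono) auto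
  also have "\<dots> = s * (a + \<theta> * s)"
    by (simp add: power2_eq_square algebra_simps)
  finally have "u * (a + \<theta> * s) * (a + \<theta> * s) \<le> s * (a + \<theta> * s)"
    by (simp add: power2_eq_square mult.assoc)
  moreover have pos: "0 < a + \<theta> * s" using assms(3,4) s by (simp add: add_pos_nonneg)
  ultimately have "u * (a + \<theta> * s) \<le> s" by simp
  then show ?thesis using pos by (simp add: u_def s_def field_simps)
qed

subsection \<open>The logarithm along a segment\<close>

lemma spec_decomposition_ge:
  assumes "psd (A - e *\<^sub>R mat 1)"
  obtains U d where "unitary_mat U" "A = spec U d" "\<And>i. e \<le> d i"
    "\<And>f. mat_fun f A = spec U (\<lambda>i. f (d i))"
proof -
  obtain U d where U: "unitary_mat U" "A - e *\<^sub>R mat 1 = spec U d"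
    using spectral_decomposition[OF psd_hermitian[OF assms]] by blast
  have "A = spec U d + e *\<^sub>R mat 1" using U(2) by (simp add: algebra_simps)
  then have A: "A = spec U (\<lambda>i. d i + e)"
    by (simp add: spec_add flip: spec_const[OF U(1)])
  have "\<forall>i. 0 \<le> d i" using assms by (simp add: U psd_spec_iff)
  then show ?thesis using that[OF U(1) A] by (simp add: A mat_fun_spec[OF U(1)])
qed

text \<open>Operator monotonicity from the tangent bound taken at the larger matrix
  \<open>A + Y\<close>: the step \<open>- Y\<close> pairs with \<open>P\<close> to a nonpositive
  number.\<close>

lemma mtrace_ln_mono:
  assumes "0 < e" and A: "psd (A - e *\<^sub>R mat 1)" and Y: "psd Y" and P: "psd P"
  shows "Re (mtrace (P ** mat_fun ln A)) \<le> Re (mtrace (P ** mat_fun ln (A + Y)))"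
proof -
  have B: "psd ((A + Y) - e *\<^sub>R mat 1)" using psd_add[OF A Y] by (simp add: algebra_simps)
  from spec_decomposition_ge[OF A] obtain U d where
    U: "unitary_mat U" "A = spec U d" "\<And>i. e \<le> d i" "mat_fun ln A = spec U (\<lambda>i. ln (d i))" by metis
  from spec_decomposition_ge[OF B] obtain V b where
    V: "unitary_mat V" "A + Y = spec V b" "\<And>i. e \<le> b i" "mat_fun ln (A + Y) = spec V (\<lambda>i. ln (b i))" by metis
  have pos: "0 < d i" "0 < b i" for i using assms(1) U(3)[of i] V(3)[of i] by auto
  have "Re (mtrace (P ** mat_fun ln A)) - Re (mtrace (P ** mat_fun ln (A + Y)))
      \<le> log_form V b P (spec U d - spec V b)"
    unfolding U(4) V(4) by (intro log_tangent U V pos P)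
  also have "spec U d - spec V b = 0 - Y"
    unfolding U(2)[symmetric] V(2)[symmetric] by simp
  also have "log_form V b P (0 - Y) \<le> 0"
    unfolding log_form_diff_right
    using log_form_nonneg[OF pos(2) P Y] log_form_scaleR_right[of V b P 0 0] by simp
  finally show ?thesis by simp
qed

text \<open>One step along the segment: the tangent bound at the left end, estimated by
  \<open>log_form_le\<close>. The left end enters only through its domination of
  \<open>a P + \<theta> X\<close>.\<close>

lemma mtrace_ln_step:
  assumes "0 < e" and A: "psd (A - e *\<^sub>R mat 1)" and "0 < a" "0 \<le> \<theta>" "0 \<le> h"
    and P: "psd P" "mtrace P = 1" and X: "psd X" and dom: "psd (A - a *\<^sub>R P - \<theta> *\<^sub>R X)"
  shows "Re (mtrace (P ** mat_fun ln (A + h *\<^sub>R X))) - Re (mtrace (P ** mat_fun ln A))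
    \<le> h * Re (mtrace X) / (a + \<theta> * Re (mtrace X))"
proof -
  have B: "psd ((A + h *\<^sub>R X) - e *\<^sub>R mat 1)"
    using psd_add[OF A psd_scaleR[OF X \<open>0 \<le> h\<close>]] by (simp add: algebra_simps)
  from spec_decomposition_ge[OF A] obtain U d where
    U: "unitary_mat U" "A = spec U d" "\<And>i. e \<le> d i" "mat_fun ln A = spec U (\<lambda>i. ln (d i))" by metis
  from spec_decomposition_ge[OF B] obtain V b where
    V: "unitary_mat V" "A + h *\<^sub>R X = spec V b" "\<And>i. e \<le> b i"
      "mat_fun ln (A + h *\<^sub>R X) = spec V (\<lambda>i. ln (b i))" by metis
  have pos: "0 < d i" "0 < b i" for i using assms(1) U(3)[of i] V(3)[of i] by auto
  have "Re (mtrace (P ** mat_fun ln (A + h *\<^sub>R X))) - Re (mtrace (P ** mat_fun ln A))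
      \<le> log_form U d P (spec V b - spec U d)"
    unfolding U(4) V(4) by (intro log_tangent U V pos P)
  also have "spec V b - spec U d = h *\<^sub>R X"
    unfolding U(2)[symmetric] V(2)[symmetric] by simp
  also have "log_form U d P (h *\<^sub>R X) = h * log_form U d P X" by (rule log_form_scaleR_right)
  also have "\<dots> \<le> h * (Re (mtrace X) / (a + \<theta> * Re (mtrace X)))"
    using dom unfolding U(2) by (intro mult_left_mono log_form_le U pos assms) auto
  finally show ?thesis by simp
qed

text \<open>Converts a linear step bound into a logarithmic increment at the cost of a second-order
  error.\<close>

lemma ln_one_plus_ge: "x - x\<^sup>2 \<le> ln (1 + x)" if "0 \<le> x" for x :: real
proof -
  have "ln (1 / (1 + x)) \<le> 1 / (1 + x) - 1" using that by (intro ln_le_minus_one) simp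
  moreover have "ln (1 / (1 + x)) = - ln (1 + x)" using that by (simp add: ln_div)
  moreover have "x - x\<^sup>2 \<le> 1 - 1 / (1 + x)"
    using that by (simp add: field_simps power2_eq_square)
  ultimately show ?thesis by linarith
qed

text \<open>Summing the tangent bounds over \<open>N\<close> equal steps gives a Riemann sum of \<open>s / (a + \<theta> * s)\<close>
  over \<open>\<theta> \<in> {0..1}\<close>, with error of order \<open>1 / N\<close>.\<close>

lemma mtrace_ln_add_le:
  assumes "0 < e" and A: "psd (A - e *\<^sub>R mat 1)" and "0 < a"
    and P: "psd P" "mtrace P = 1" and X: "psd X" and dom: "psd (A - a *\<^sub>R P)"
  shows "Re (mtrace (P ** mat_fun ln (A + X))) - Re (mtrace (P ** mat_fun ln A))
    \<le> ln (a + Re (mtrace X)) - ln a"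
proof -
  define s where "s = Re (mtrace X)"
  have s: "0 \<le> s" unfolding s_def by (rule psd_mtrace_nonneg[OF X])
  define L where "L t = Re (mtrace (P ** mat_fun ln (A + t *\<^sub>R X)))" for t
  have bound: "L 1 - L 0 \<le> (ln (a + s) - ln a) + (s / a)\<^sup>2 * (1 / real N)" if "0 < N" for N
  proof -
    \<comment> \<open>Every step contributes an error of at most
      \<open>(s / (N * a))\<^sup>2\<close>, because \<open>a + t * s \<ge> a\<close>.\<close>
    have "L (real k / N) - L 0 \<le> ln (a + (k / N) * s) - ln a + k * (s / (N * a))\<^sup>2" for k
    proof (induction k)
      case (Suc k)
      define t where "t = real k / N"
      have t: "0 \<le> t" by (simp add: t_def)
      have t1: "real (Suc k) / N = t + 1 / N" by (simp add: t_def add_divide_distrib)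
      define x where "x = (1 / N) * s / (a + t * s)"
      have pos: "0 < a + t * s" using \<open>0 < a\<close> t s by (simp add: add_pos_nonneg)
      have x0: "0 \<le> x" using pos s by (simp add: x_def)
      have "L (t + 1 / N) - L t \<le> x"
      proof -
        have At: "psd ((A + t *\<^sub>R X) - e *\<^sub>R mat 1)"
          using psd_add[OF A psd_scaleR[OF X t]] by (simp add: algebra_simps)
        have "psd ((A + t *\<^sub>R X) - a *\<^sub>R P - t *\<^sub>R X)" using dom by (simp add: algebra_simps)
        from mtrace_ln_step[OF \<open>0 < e\<close> At \<open>0 < a\<close> t _ P X this, of "1 / N"]
        show ?thesis by (simp add: L_def x_def s_def algebra_simps)
      qed
      also have "x \<le> ln (1 + x) + x\<^sup>2" using ln_one_plus_ge[OF x0] by simp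
      \<comment> \<open>\<open>1 + x\<close> is the ratio of consecutive values of
        \<open>a + t * s\<close>, so the main terms telescope exactly.\<close>
      also have "ln (1 + x) = ln (a + (t + 1 / N) * s) - ln (a + t * s)"
      proof -
        have "1 + x = (a + (t + 1 / N) * s) / (a + t * s)"
          using pos by (simp add: eq_divide_eq x_def distrib_right)
        moreover have "0 < a + (t + 1 / N) * s" using \<open>0 < a\<close> t s by (simp add: add_pos_nonneg)
        ultimately show ?thesis using pos by (simp add: ln_div)
      qed
      also have "x\<^sup>2 \<le> (s / (N * a))\<^sup>2"
      proof -
        have "x = s / (N * (a + t * s))" by (simp add: x_def)
        also have "\<dots> \<le> s / (N * a)"
          using \<open>0 < a\<close> t s \<open>0 < N\<close> pos by (intro divide_left_mono mult_left_mono mult_pos_pos) auto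
        finally show ?thesis using x0 by (intro power_mono)
      qed
      finally have "L (t + 1 / N) - L t \<le> ln (a + (t + 1 / N) * s) - ln (a + t * s) + (s / (N * a))\<^sup>2" by simp
      with Suc show ?case unfolding t1 by (simp add: t_def algebra_simps)
    qed simp
    from this[of N] that have "L 1 - L 0 \<le> ln (a + s) - ln a + N * (s / (N * a))\<^sup>2" by simp
    also have "N * (s / (N * a))\<^sup>2 = (s / a)\<^sup>2 * (1 / N)"
      using that by (simp add: power2_eq_square)
    finally show ?thesis by simp
  qed
  have "((\<lambda>N. (ln (a + s) - ln a) + (s / a)\<^sup>2 * (1 / real N)) \<longlongrightarrow> (ln (a + s) - ln a) + (s / a)\<^sup>2 * 0) sequentially"
    by (intro tendsto_intros lim_1_over_n)
  then have "L 1 - L 0 \<le> (ln (a + s) - ln a) + (s / a)\<^sup>2 * 0"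
  proof (rule tendsto_lowerbound)
    show "\<forall>\<^sub>F N in sequentially. L 1 - L 0 \<le> (ln (a + s) - ln a) + (s / a)\<^sup>2 * (1 / real N)"
      using eventually_gt_at_top[of 0] by eventually_elim (rule bound)
  qed simp
  then show ?thesis by (simp add: L_def s_def)
qed

section \<open>Limits at singular matrices\<close>

text \<open>The eigenvector \<open>U *v axis i 1\<close> lies in the kernel of
  \<open>spec U d\<close>, hence in that of \<open>P\<close>.\<close>

lemma supp_le_diag_zero:
  assumes U: "unitary_mat U" and "supp_le P (spec U d)" "d i = 0"
  shows "(madj U ** P ** U) $ j $ i = 0"
proof -
  let ?x = "U *v axis i 1"
  have "spec U d *v ?x = U *v ((madj U ** spec U d ** U) *v axis i 1)"
    by (simp add: matrix_vector_mul_assoc matrix_mul_assoc unitary_matD[OF U])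
  also have "(madj U ** spec U d ** U) *v axis i 1 = 0"
    using assms(3) by (simp add: spec_conjugate[OF U] vec_eq_iff matrix_axis_nth mdiag_nth)
  finally have "P *v ?x = 0" using assms(2) by (simp add: supp_le_def)
  then have "(madj U ** P ** U) *v axis i 1 = 0" by (simp flip: matrix_vector_mul_assoc)
  then show ?thesis using matrix_axis_nth[of "madj U ** P ** U" i j] by simp
qed

text \<open>Only terms with \<open>d i = 0\<close> could diverge, and their weights vanish by the
  support inclusion, in agreement with the value 0 in \<open>log_supp\<close>.\<close>

lemma mtrace_ln_shift_tendsto:
  assumes D: "psd D" and "supp_le P D"
  shows "((\<lambda>e. Re (mtrace (P ** mat_fun ln (D + e *\<^sub>R mat 1)))) \<longlongrightarrow> Re (mtrace (P ** log_supp D))) (at_right 0)"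
proof -
  obtain U d where U: "unitary_mat U" "D = spec U d"
    using spectral_decomposition[OF psd_hermitian[OF D]] by blast
  have d: "0 \<le> d i" for i using D by (simp add: U psd_spec_iff)
  let ?p = "\<lambda>i. Re ((madj U ** P ** U) $ i $ i)"
  have "mat_fun ln (D + e *\<^sub>R mat 1) = spec U (\<lambda>i. ln (d i + e))" for e
    by (simp add: U spec_add mat_fun_spec flip: spec_const[OF U(1)])
  then have 1: "Re (mtrace (P ** mat_fun ln (D + e *\<^sub>R mat 1))) = (\<Sum>i\<in>UNIV. ?p i * ln (d i + e))" for e
    by (simp add: Re_mtrace_mult_spec)
  have 2: "Re (mtrace (P ** log_supp D)) = (\<Sum>i\<in>UNIV. ?p i * (if 0 < d i then ln (d i) else 0))"
    unfolding log_supp_def U(2) mat_fun_spec[OF U(1)] Re_mtrace_mult_spec ..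
  have "((\<lambda>e. ?p i * ln (d i + e)) \<longlongrightarrow> ?p i * (if 0 < d i then ln (d i) else 0)) (at_right 0)" for i
  proof (cases "d i = 0")
    case True
    then show ?thesis using supp_le_diag_zero[OF U(1), of P d i i] assms(2) by (simp add: U(2))
  next
    case False
    have "((\<lambda>e. ?p i * ln (d i + e)) \<longlongrightarrow> ?p i * ln (d i + 0)) (at_right 0)"
      using False by (intro tendsto_intros) auto
    then show ?thesis using False d[of i] by simp
  qed
  then show ?thesis unfolding 1 2 by (intro tendsto_sum)
qed

text \<open>After a shift by \<open>e\<close>, monotonicity leads from \<open>B\<close> to
  \<open>B + Y = A + X\<close>, where the bound for adding \<open>X\<close> to \<open>A\<close>
  applies; then \<open>e\<close> tends to 0.\<close>

lemma mtrace_log_supp_le: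
  assumes "0 < a" and P: "psd P" "mtrace P = 1"
    and A: "psd (A - a *\<^sub>R P)" and B: "psd B" "supp_le P B" and X: "psd X" and Y: "psd Y" and eq: "A + X = B + Y"
  shows "Re (mtrace (P ** log_supp B)) - Re (mtrace (P ** log_supp A)) \<le> ln (a + Re (mtrace X)) - ln a"
proof -
  have aP: "psd (a *\<^sub>R P)" using psd_scaleR[OF P(1)] \<open>0 < a\<close> by simp
  have A': "psd A" using psd_add[OF A aP] by simp
  have supp: "supp_le P A"
    unfolding supp_le_def
  proof (intro allI impI)
    fix x assume "A *v x = 0"
    then have "(a *\<^sub>R P) *v x = 0" using psd_sum_ker[OF aP A, of x] by simp
    then show "P *v x = 0" using \<open>0 < a\<close> by (simp add: matrix_vector_scaleR)
  qed
  let ?L = "\<lambda>D e. Re (mtrace (P ** mat_fun ln (D + e *\<^sub>R mat 1)))"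
  have "((\<lambda>e. ?L B e - ?L A e) \<longlongrightarrow> Re (mtrace (P ** log_supp B)) - Re (mtrace (P ** log_supp A))) (at_right 0)"
    by (intro tendsto_diff mtrace_ln_shift_tendsto A' B supp)
  then show ?thesis
  proof (rule tendsto_upperbound)
    show "\<forall>\<^sub>F e in at_right 0. ?L B e - ?L A e \<le> ln (a + Re (mtrace X)) - ln a"
      using eventually_at_right_less[of 0]
    proof eventually_elim
      case (elim e)
      have one: "psd (e *\<^sub>R mat 1)" using elim by (intro psd_scaleR) (auto simp: psd_cdot cdot_self)
      have "?L B e \<le> Re (mtrace (P ** mat_fun ln (B + e *\<^sub>R mat 1 + Y)))"
        using B(1) by (intro mtrace_ln_mono[OF elim] Y P) simp
      also have "B + e *\<^sub>R mat 1 + Y = A + e *\<^sub>R mat 1 + X" using eq by (simp add: algebra_simps)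
      finally have "?L B e \<le> Re (mtrace (P ** mat_fun ln (A + e *\<^sub>R mat 1 + X)))" .
      moreover have "Re (mtrace (P ** mat_fun ln (A + e *\<^sub>R mat 1 + X))) - ?L A e \<le> ln (a + Re (mtrace X)) - ln a"
      proof (rule mtrace_ln_add_le[OF elim _ \<open>0 < a\<close> P X])
        show "psd (A + e *\<^sub>R mat 1 - a *\<^sub>R P)" using psd_add[OF A one] by (simp add: algebra_simps)
      qed (use A' in simp)
      ultimately show ?case by simp
    qed
  qed simp
qed

subsection \<open>Telescopic relative entropy\<close>

text \<open>Jordan decomposition \<open>\<sigma>1 - \<sigma>2 = X - Y\<close>. As the difference is
  traceless, both parts have the same trace.\<close>

lemma trace_dist_decomposition:
  assumes "psd \<sigma>1" "psd \<sigma>2" "mtrace \<sigma>1 = mtrace \<sigma>2"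
  obtains X Y where "psd X" "psd Y" "\<sigma>1 + Y = \<sigma>2 + X"
    "Re (mtrace X) = trace_dist \<sigma>1 \<sigma>2" "Re (mtrace Y) = trace_dist \<sigma>1 \<sigma>2"
proof -
  have "hermitian_mat (\<sigma>1 - \<sigma>2)"
    using assms(1,2)[THEN psd_hermitian] by (simp add: hermitian_mat_def madj_diff)
  then obtain U d where U: "unitary_mat U" "\<sigma>1 - \<sigma>2 = spec U d"
    using spectral_decomposition by blast
  define X Y where "X = spec U (\<lambda>i. max (d i) 0)" and "Y = spec U (\<lambda>i. max (- d i) 0)"
  have psd: "psd X" "psd Y" by (simp_all add: X_def Y_def psd_spec_iff[OF U(1)])
  have "spec U d + Y = X"
    unfolding X_def Y_def spec_add by (rule arg_cong[of _ _ "spec U"]) auto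
  then have eq: "\<sigma>1 + Y = \<sigma>2 + X"
    unfolding U(2)[symmetric] by (simp add: algebra_simps)
  have X: "Re (mtrace X) = trace_dist \<sigma>1 \<sigma>2"
    by (simp add: trace_dist_def pos_part_def U(2) mat_fun_spec[OF U(1)] X_def)
  have "mtrace (\<sigma>1 + Y) = mtrace (\<sigma>2 + X)" by (simp add: eq)
  then have "mtrace Y = mtrace X" using assms(3) by (simp add: mtrace_add)
  with that psd eq X show ?thesis by simp
qed

lemma supp_le_convex_combination:
  assumes "psd \<rho>" "psd \<sigma>" "0 < a" "a < 1"
  shows "supp_le \<rho> (a *\<^sub>R \<rho> + (1 - a) *\<^sub>R \<sigma>)"
  unfolding supp_le_def
proof (intro allI impI)
  fix x assume "(a *\<^sub>R \<rho> + (1 - a) *\<^sub>R \<sigma>) *v x = 0"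
  then have "(a *\<^sub>R \<rho>) *v x = 0"
    using assms by (intro psd_sum_ker[of "a *\<^sub>R \<rho>" "(1 - a) *\<^sub>R \<sigma>"] psd_scaleR) auto
  then show "\<rho> *v x = 0" using assms(3) by (simp add: matrix_vector_scaleR)
qed

text \<open>The mixture contains \<open>a \<rho>\<close>, so the infinite branch of
  \<open>rel_ent\<close> does not occur.\<close>

lemma tel_rel_ent_eq:
  assumes "psd \<rho>" "psd \<sigma>" "0 < a" "a < 1"
  shows "tel_rel_ent a \<rho> \<sigma> = ereal ((Re (mtrace (\<rho> ** log_supp \<rho>))
     - Re (mtrace (\<rho> ** log_supp (a *\<^sub>R \<rho> + (1 - a) *\<^sub>R \<sigma>)))) / (- ln a))"
  using assms by (simp add: tel_rel_ent_def rel_ent_def supp_le_convex_combination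
      matrix_diff_ldistrib mtrace_diff)

section \<open>The equality case\<close>

text \<open>In an eigenbasis of \<open>Q\<close> the trace is a sum of nonnegative terms, so each is
  0. Where \<open>q i\<close> is nonzero, the diagonal entry of \<open>P\<close> vanishes, and by
  \<open>psd_ker\<close> so does its column.\<close>

lemma psd_mult_eq_0:
  assumes "psd P" "psd Q" "mtrace (P ** Q) = 0"
  shows "P ** Q = 0"
proof -
  obtain V q where V: "unitary_mat V" "Q = spec V q"
    using spectral_decomposition[OF psd_hermitian[OF assms(2)]] by blast
  have q: "0 \<le> q i" for i using assms(2) by (simp add: V psd_spec_iff)
  let ?P = "madj V ** P ** V"
  have psd: "psd ?P" by (rule psd_congruence[OF assms(1)])
  have "(\<Sum>i\<in>UNIV. Re (?P $ i $ i) * q i) = 0"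
    using assms(3) by (simp add: V(2) flip: Re_mtrace_mult_spec)
  then have "\<forall>i\<in>UNIV. Re (?P $ i $ i) * q i = 0"
    using q psd by (subst (asm) sum_nonneg_eq_0_iff) (auto intro!: mult_nonneg_nonneg psd_diag_nonneg)
  then have z: "?P $ j $ i * complex_of_real (q i) = 0" for i j
  proof (cases "q i = 0")
    case False
    have "cdot (axis i 1) (?P *v axis i 1) = 0"
      using \<open>\<forall>i\<in>UNIV. _\<close> False psd[unfolded psd_cdot, rule_format, of "axis i 1"]
      by (auto simp: axis_matrix_nth complex_eq_iff)
    then have "?P *v axis i 1 = 0" by (rule psd_ker[OF psd])
    then show ?thesis using matrix_axis_nth[of ?P i j] by simp
  qed simp
  have "P ** Q = V ** (?P ** mdiag (\<lambda>i. complex_of_real (q i))) ** madj V"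
  proof -
    have "V ** (?P ** mdiag (\<lambda>i. complex_of_real (q i))) ** madj V = (V ** madj V) ** P ** spec V q"
      by (simp add: spec_def matrix_mul_assoc)
    then show ?thesis by (simp add: V(2) unitary_matD[OF V(1)])
  qed
  also have "?P ** mdiag (\<lambda>i. complex_of_real (q i)) = 0"
    by (intro matrix_eqI) (simp add: mult_mdiag_nth z)
  finally show ?thesis by (simp add: matrix_matrix_mult_def vec_eq_iff)
qed

text \<open>Meant for the two mixtures with \<open>\<kappa> = a / c\<close>. They need not be
  proportional, but the relation \<open>A ** P = P ** (\<kappa> B)\<close> passes to logarithms by
  \<open>spec_intertwine\<close>, and \<open>ln (\<kappa> * b i)\<close> splits wherever
  \<open>P\<close> has weight.\<close>

lemma mtrace_log_supp_scale:
  assumes P: "psd P" "mtrace P = 1" and A: "psd A" and B: "psd B" "supp_le P B"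
    and "0 < \<kappa>" and eq: "A ** P = \<kappa> *\<^sub>R (P ** B)"
  shows "Re (mtrace (P ** log_supp A)) = ln \<kappa> + Re (mtrace (P ** log_supp B))"
proof -
  let ?f = "\<lambda>x. if x > 0 then ln x else (0::real)"
  obtain U d where U: "unitary_mat U" "A = spec U d"
    using spectral_decomposition[OF psd_hermitian[OF A]] by blast
  obtain V b where V: "unitary_mat V" "B = spec V b"
    using spectral_decomposition[OF psd_hermitian[OF B(1)]] by blast
  have b: "0 \<le> b i" for i using B(1) by (simp add: V psd_spec_iff)
  let ?p = "\<lambda>i. Re ((madj V ** P ** V) $ i $ i)"
  have "spec U d ** P = P ** spec V (\<lambda>i. \<kappa> * b i)"
    using eq by (simp add: U V matrix_scaleR_right flip: spec_scaleR)
  from spec_intertwine[OF U(1) V(1) this, of ?f]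
  have "log_supp A ** P = P ** spec V (\<lambda>i. ?f (\<kappa> * b i))"
    by (simp add: log_supp_def U mat_fun_spec)
  then have "Re (mtrace (P ** log_supp A)) = (\<Sum>i\<in>UNIV. ?p i * ?f (\<kappa> * b i))"
    by (subst mtrace_mult_commute) (simp add: Re_mtrace_mult_spec)
  also have "\<dots> = (\<Sum>i\<in>UNIV. ?p i * ln \<kappa> + ?p i * ?f (b i))"
  proof (intro sum.cong refl)
    fix i
    show "?p i * ?f (\<kappa> * b i) = ?p i * ln \<kappa> + ?p i * ?f (b i)"
    proof (cases "b i = 0")
      case True
      then show ?thesis using supp_le_diag_zero[OF V(1), of P b i i] B(2) by (simp add: V(2))
    next
      case False
      then have "0 < b i" using b[of i] by simp
      then show ?thesis using \<open>0 < \<kappa>\<close> by (simp add: ln_mult distrib_left)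
    qed
  qed
  also have "\<dots> = (\<Sum>i\<in>UNIV. ?p i) * ln \<kappa> + (\<Sum>i\<in>UNIV. ?p i * ?f (b i))"
    by (simp only: sum.distrib sum_distrib_right)
  also have "(\<Sum>i\<in>UNIV. ?p i) = 1"
    using mtrace_conjugate[OF V(1), of P] P(2) by (simp add: mtrace_def flip: Re_sum)
  also have "(\<Sum>i\<in>UNIV. ?p i * ?f (b i)) = Re (mtrace (P ** log_supp B))"
    unfolding log_supp_def V(2) mat_fun_spec[OF V(1)] Re_mtrace_mult_spec ..
  finally show ?thesis by simp
qed

section \<open>The two-sided bound, its linear form and equality\<close>

theorem theorem3:
  fixes \<rho> \<sigma>1 \<sigma>2 :: "complex^'n::finite^'n"
    and a t :: real
  assumes "0 < a" and "a < 1"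
    and "is_state \<rho>" and "is_state \<sigma>1" and "is_state \<sigma>2"
    and "trace_dist \<sigma>1 \<sigma>2 = t"
  shows "\<bar>tel_rel_ent a \<rho> \<sigma>1 - tel_rel_ent a \<rho> \<sigma>2\<bar> \<le> ereal (1 - tel_rel_ent_scalar a 1 t) \<and>
         1 - tel_rel_ent_scalar a 1 t = (ln (a + (1 - a) * t) - ln a) / (- ln a) \<and>
         (ln (a + (1 - a) * t) - ln a) / (- ln a) \<le> (1 - a) / (- a * ln a) * t \<and>
         (mtrace (\<rho> ** \<sigma>1) = 0 \<and> \<sigma>2 = t *\<^sub>R \<rho> + (1 - t) *\<^sub>R \<sigma>1 \<longrightarrow>
         \<bar>tel_rel_ent a \<rho> \<sigma>1 - tel_rel_ent a \<rho> \<sigma>2\<bar> = ereal (1 - tel_rel_ent_scalar a 1 t))"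
proof -
  have \<rho>: "psd \<rho>" "mtrace \<rho> = 1" and \<sigma>1: "psd \<sigma>1" "mtrace \<sigma>1 = 1" and \<sigma>2: "psd \<sigma>2" "mtrace \<sigma>2 = 1"
    using assms(3-5) by (auto simp: is_state_def)
  have lna: "0 < - ln a" using assms(1,2) by simp
  have "mtrace \<sigma>1 = mtrace \<sigma>2" by (simp add: \<sigma>1 \<sigma>2)
  from trace_dist_decomposition[OF \<sigma>1(1) \<sigma>2(1) this]
  obtain X Y where XY: "psd X" "psd Y" "\<sigma>1 + Y = \<sigma>2 + X" and tr: "Re (mtrace X) = t" "Re (mtrace Y) = t"
    unfolding assms(6) .
  have t: "0 \<le> t" using psd_mtrace_nonneg[OF XY(1)] tr by simp
  define c where "c = a + (1 - a) * t"
  have c: "a \<le> c" "0 < c" using assms(1,2) t by (auto simp: c_def add_pos_nonneg)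
  define D where "D \<sigma> = a *\<^sub>R \<rho> + (1 - a) *\<^sub>R \<sigma>" for \<sigma>
  define l where "l \<sigma> = Re (mtrace (\<rho> ** log_supp (D \<sigma>)))" for \<sigma>
  have psd_part: "psd ((1 - a) *\<^sub>R \<sigma>)" if "psd \<sigma>" for \<sigma>
    using psd_scaleR[OF that] assms(2) by simp
  have psdD: "psd (D \<sigma>)" if "psd \<sigma>" for \<sigma>
    unfolding D_def using assms(1) by (intro psd_add psd_part that psd_scaleR[OF \<rho>(1)]) simp
  have supp: "supp_le \<rho> (D \<sigma>)" if "psd \<sigma>" for \<sigma>
    unfolding D_def using supp_le_convex_combination \<rho>(1) that assms(1,2) by blast
  \<comment> \<open>Kept general in the pair: the absolute value needs both orders, with
    \<open>X\<close> and \<open>Y\<close> exchanged.\<close>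
  have le: "l \<tau> - l \<sigma> \<le> ln c - ln a"
    if "psd \<sigma>" "psd \<tau>" "psd Z" "psd W" "\<sigma> + Z = \<tau> + W" "Re (mtrace Z) = t" for \<sigma> \<tau> Z W
  proof -
    have "l \<tau> - l \<sigma> \<le> ln (a + Re (mtrace ((1 - a) *\<^sub>R Z))) - ln a"
      unfolding l_def
    proof (rule mtrace_log_supp_le[OF assms(1) \<rho>])
      show "psd (D \<sigma> - a *\<^sub>R \<rho>)" using psd_part[OF that(1)] by (simp add: D_def)
      have "(1 - a) *\<^sub>R (\<sigma> + Z) = (1 - a) *\<^sub>R (\<tau> + W)" by (simp add: that(5))
      then show "D \<sigma> + (1 - a) *\<^sub>R Z = D \<tau> + (1 - a) *\<^sub>R W"
        by (simp add: D_def scaleR_add_right)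
    qed (intro that psdD supp psd_part)+
    then show ?thesis by (simp add: mtrace_scaleR that(6) c_def)
  qed
  have diff: "\<bar>tel_rel_ent a \<rho> \<sigma>1 - tel_rel_ent a \<rho> \<sigma>2\<bar> = ereal (\<bar>l \<sigma>2 - l \<sigma>1\<bar> / (- ln a))"
  proof -
    define k h where "k = - ln a" and "h = Re (mtrace (\<rho> ** log_supp \<rho>))"
    have "tel_rel_ent a \<rho> \<sigma> = ereal ((h - l \<sigma>) / k)" if "psd \<sigma>" for \<sigma>
      unfolding k_def h_def l_def D_def by (rule tel_rel_ent_eq[OF \<rho>(1) that assms(1,2)])
    then have "tel_rel_ent a \<rho> \<sigma>1 - tel_rel_ent a \<rho> \<sigma>2 = ereal ((l \<sigma>2 - l \<sigma>1) / k)"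
      using \<sigma>1(1) \<sigma>2(1) by (simp add: diff_divide_distrib)
    moreover have "\<bar>(l \<sigma>2 - l \<sigma>1) / k\<bar> = \<bar>l \<sigma>2 - l \<sigma>1\<bar> / k"
      using lna unfolding k_def[symmetric] by (simp add: abs_divide)
    ultimately show ?thesis by (simp add: k_def)
  qed
  have scalar: "1 - tel_rel_ent_scalar a 1 t = (ln c - ln a) / (- ln a)"
  proof -
    have "1 - tel_rel_ent_scalar a 1 t = 1 - (- ln c) / (- ln a)"
      by (simp add: tel_rel_ent_scalar_def c_def)
    also have "\<dots> = (- ln a - (- ln c)) / (- ln a)"
      using lna by (simp only: diff_divide_distrib divide_self_if) simp
    finally show ?thesis by simp
  qed
  have "\<bar>l \<sigma>2 - l \<sigma>1\<bar> \<le> ln c - ln a"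
    using le[OF \<sigma>1(1) \<sigma>2(1) XY(2,1,3) tr(2)] le[OF \<sigma>2(1) \<sigma>1(1) XY(1,2) XY(3)[symmetric] tr(1)]
    by simp
  then have bound: "\<bar>tel_rel_ent a \<rho> \<sigma>1 - tel_rel_ent a \<rho> \<sigma>2\<bar> \<le> ereal (1 - tel_rel_ent_scalar a 1 t)"
    unfolding diff scalar using lna by (simp only: ereal_less_eq(3)) (rule divide_right_mono, auto)
  have linear: "(ln c - ln a) / (- ln a) \<le> (1 - a) / (- a * ln a) * t"
  proof -
    have "ln c - ln a = ln (c / a)" using c(2) assms(1) by (simp add: ln_div)
    also have "\<dots> \<le> c / a - 1" using c(2) assms(1) by (intro ln_le_minus_one) simp
    also have "\<dots> = (1 - a) * t / a" using assms(1) by (simp add: c_def field_simps)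
    finally have "(ln c - ln a) / (- ln a) \<le> ((1 - a) * t / a) / (- ln a)"
      using lna by (intro divide_right_mono) auto
    also have "\<dots> = (1 - a) / (- a * ln a) * t" by simp
    finally show ?thesis .
  qed
  have equality: "\<bar>tel_rel_ent a \<rho> \<sigma>1 - tel_rel_ent a \<rho> \<sigma>2\<bar> = ereal (1 - tel_rel_ent_scalar a 1 t)"
    if "mtrace (\<rho> ** \<sigma>1) = 0" and \<sigma>2_eq: "\<sigma>2 = t *\<^sub>R \<rho> + (1 - t) *\<^sub>R \<sigma>1"
  proof -
    have \<rho>\<sigma>: "\<rho> ** \<sigma>1 = 0" using psd_mult_eq_0[OF \<rho>(1) \<sigma>1(1)] that(1) by simp
    have \<sigma>\<rho>: "\<sigma>1 ** \<rho> = 0"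
      using psd_mult_eq_0[OF \<sigma>1(1) \<rho>(1)] that(1) mtrace_mult_commute[of \<rho> \<sigma>1] by simp
    \<comment> \<open>By orthogonality the products of \<open>D \<sigma>1\<close> and
      \<open>D \<sigma>2\<close> with \<open>\<rho>\<close> are \<open>a\<close> and
      \<open>c\<close> times \<open>\<rho> ** \<rho>\<close>; hence the ratio \<open>a / c\<close>,
      which attains the bound.\<close>
    have "D \<sigma>2 = c *\<^sub>R \<rho> + ((1 - a) * (1 - t)) *\<^sub>R \<sigma>1"
      unfolding D_def \<sigma>2_eq c_def by (simp add: scaleR_add_left scaleR_add_right)
    then have "\<rho> ** D \<sigma>2 = c *\<^sub>R (\<rho> ** \<rho>)" by (simp add: matrix_distribs \<rho>\<sigma>)
    moreover have "D \<sigma>1 ** \<rho> = a *\<^sub>R (\<rho> ** \<rho>)" by (simp add: D_def matrix_distribs \<sigma>\<rho>)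
    ultimately have "D \<sigma>1 ** \<rho> = (a / c) *\<^sub>R (\<rho> ** D \<sigma>2)" using c(2) by simp
    then have "l \<sigma>1 = ln (a / c) + l \<sigma>2"
      unfolding l_def using assms(1) c(2)
      by (intro mtrace_log_supp_scale[OF \<rho> psdD[OF \<sigma>1(1)] psdD[OF \<sigma>2(1)] supp[OF \<sigma>2(1)]]) simp_all
    then have "l \<sigma>2 - l \<sigma>1 = ln c - ln a" using assms(1) c(2) by (simp add: ln_div)
    moreover have "ln a \<le> ln c" using c assms(1) by simp
    ultimately show ?thesis unfolding diff scalar by simp
  qed
  show ?thesis
    by (intro conjI impI bound scalar[unfolded c_def] linear[unfolded c_def]) (elim conjE, rule equality)
qed

end
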